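(* Let $A,B>0$, $k\in\mathbb R\setminus\{0\}$, and let $\chi_0\in\mathbb R\setminus\{0,k,-k\}$ satisfy $\Lambda'(\chi_0)=0$, $\Lambda''(\chi_0)\neq0$. With the notation of the context, a nonzero vector of the form $$\mathbf y_R=M_0\mathbf Y_0+M_1\mathbf Y_1+c_s\mathbf Y_s,\qquad M_0,M_1,c_s\in\mathbb C,$$ can be $J$-null (i.e. $\langle\mathbf y_R|J|\mathbf y_R\rangle=0$) only if $M_0\ne0$. After the normalization $M_0=1$, the null condition is $$b_J|M_1|^2+2a_J\operatorname{Re}M_1+d_s|c_s|^2=0,$$ equivalently $$\left(\operatorname{Re}M_1+\frac{a_J}{b_J}\right)^2+(\operatorname{Im}M_1)^2=\left(\frac{a_J}{b_J}\right)^2-\frac{d_s}{b_J}|c_s|^2 .$$ Consequently, the simple branch can occur with coefficient $c_s$ in a null leading vector with $M_0=1$ (i.e. there exists $M_1\in\mathbb C$ making $\mathbf y_R$ null) if and only if $$|c_s|^2\le\frac{a_J^2}{b_Jd_s}.$$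
   Context: $S=A+B$, $R=A-B$; $a_1,a_2\in\mathbb R$ with $a_1^2=A$, $a_2^2=B$; $k_1=k$, $k_2=-k$; $\omega_1=1/k-A$, $\omega_2=-1/k-B$; $u_{j,0}=a_j\exp[\mathrm i(k_jx+\omega_jt)]$ for $(x,t)\in\mathbb R^2$. $\Lambda(\chi)=\frac1\chi\big[2-k^2\big(\frac{A}{\chi+k}+\frac{B}{\chi-k}\big)\big]$ for $\chi\notin\{0,\pm k\}$; $F(\chi;\mu)=\chi(\chi^2-k^2)[\mu-\Lambda(\chi)]=\mu\chi^3-2\chi^2+k^2(S-\mu)\chi+k^2(2-kR)$. $\nu(\chi)=\frac S2+\frac{2-kR}{2\chi}$, $E(\chi)=\exp[\mathrm i(\chi x+\nu(\chi)t)]$, $h_1(\chi)=\frac{k}{k+\chi}$, $h_2(\chi)=\frac{k}{k-\chi}$, $\mathbf y(\chi,\lambda)=(\lambda E(\chi),u_{1,0}h_1(\chi)E(\chi),u_{2,0}h_2(\chi)E(\chi))^{\mathsf T}$. $\mu_0=\Lambda(\chi_0)$, which is automatically positive; $\lambda_0=\sqrt{\mu_0}>0$. The remaining simple root of $F(\chi;\mu_0)=\mu_0(\chi-\chi_0)^2(\chi-\chi_s)$ is $\chi_s=\frac2{\mu_0}-2\chi_0\neq\chi_0$. $\mathbf Y_0=\mathbf y(\chi_0,\lambda_0)$, $\mathbf Y_1=\partial_\chi\mathbf y(\chi,\lambda_0)|_{\chi=\chi_0}$ (at fixed $\lambda_0$), $\mathbf Y_s=\mathbf y(\chi_s,\lambda_0)$;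 if $\chi_s=0$, instead $\mathbf Y_s=\exp(\mathrm i\mu_0t/2)(\lambda_0,u_{1,0},u_{2,0})^{\mathsf T}$. $J=\operatorname{diag}(1,-1,-1)$, $\langle\mathbf f|J|\mathbf g\rangle=\mathbf f^\dagger J\mathbf g$. Define $a_J=\langle\mathbf Y_0|J|\mathbf Y_1\rangle$, $b_J=\langle\mathbf Y_1|J|\mathbf Y_1\rangle$, $d_s=\langle\mathbf Y_s|J|\mathbf Y_s\rangle$; these are real constants independent of $(x,t)$, with $a_J=-Ah_1(\chi_0)h_1'(\chi_0)-Bh_2(\chi_0)h_2'(\chi_0)\ne0$, $b_J=-Ah_1'(\chi_0)^2-Bh_2'(\chi_0)^2<0$ and $d_s<0$. *)

theory Defs
  imports "HOL-Analysis.Analysis"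
begin

text \<open>
  Throughout, \<open>S = A + B\<close> and \<open>R = A - B\<close> are written out. All spectral points
  (\<open>z\<close>, \<open>z0\<close>, \<open>chi_s\<close>) are real.
\<close>

subsection \<open>Spectral curve\<close>

definition Lambda :: "real \<Rightarrow> real \<Rightarrow> real \<Rightarrow> real \<Rightarrow> real" where
  "Lambda A B k z = (1 / z) * (2 - k^2 * (A / (z + k) + B / (z - k)))"

definition Fpoly :: "real \<Rightarrow> real \<Rightarrow> real \<Rightarrow> real \<Rightarrow> real \<Rightarrow> real" where
  "Fpoly A B k z mu =
     mu * z^3 - 2 * z^2 + k^2 * ((A + B) - mu) * z + k^2 * (2 - k * (A - B))"

definition mu0 :: "real \<Rightarrow> real \<Rightarrow> real \<Rightarrow> real \<Rightarrow> real" where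
  "mu0 A B k z0 = Lambda A B k z0"

definition lambda0 :: "real \<Rightarrow> real \<Rightarrow> real \<Rightarrow> real \<Rightarrow> real" where
  "lambda0 A B k z0 = sqrt (mu0 A B k z0)"

text \<open>The remaining root of \<open>Fpoly A B k _ (mu0 A B k z0)\<close> at a critical point \<open>z0\<close> of
  \<open>Lambda A B k\<close>; see \<open>Fpoly_factor\<close> and \<open>chi_s_neq\<close> below.\<close>

definition chi_s :: "real \<Rightarrow> real \<Rightarrow> real \<Rightarrow> real \<Rightarrow> real" where
  "chi_s A B k z0 = 2 / mu0 A B k z0 - 2 * z0"

subsection \<open>Plane waves and eigenvectors\<close>

definition u10 :: "real \<Rightarrow> real \<Rightarrow> real \<Rightarrow> real \<Rightarrow> real \<Rightarrow> complex" where
  "u10 A k a1 x t = of_real a1 * exp (\<i> * of_real (k * x + (1 / k - A) * t))"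

definition u20 :: "real \<Rightarrow> real \<Rightarrow> real \<Rightarrow> real \<Rightarrow> real \<Rightarrow> complex" where
  "u20 B k a2 x t = of_real a2 * exp (\<i> * of_real (- k * x + (- (1 / k) - B) * t))"

definition nu :: "real \<Rightarrow> real \<Rightarrow> real \<Rightarrow> real \<Rightarrow> real" where
  "nu A B k z = (A + B) / 2 + (2 - k * (A - B)) / (2 * z)"

definition Ephase :: "real \<Rightarrow> real \<Rightarrow> real \<Rightarrow> real \<Rightarrow> real \<Rightarrow> real \<Rightarrow> complex" where
  "Ephase A B k x t z = exp (\<i> * of_real (z * x + nu A B k z * t))"

definition h1 :: "real \<Rightarrow> real \<Rightarrow> real" where
  "h1 k z = k / (k + z)"

definition h2 :: "real \<Rightarrow> real \<Rightarrow> real" where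
  "h2 k z = k / (k - z)"

definition yvec ::
  "real \<Rightarrow> real \<Rightarrow> real \<Rightarrow> real \<Rightarrow> real \<Rightarrow> real \<Rightarrow> real \<Rightarrow> real \<Rightarrow> real \<Rightarrow> complex^3" where
  "yvec A B k a1 a2 x t z lam =
     vector [of_real lam * Ephase A B k x t z,
             u10 A k a1 x t * of_real (h1 k z) * Ephase A B k x t z,
             u20 B k a2 x t * of_real (h2 k z) * Ephase A B k x t z]"

definition Y0 ::
  "real \<Rightarrow> real \<Rightarrow> real \<Rightarrow> real \<Rightarrow> real \<Rightarrow> real \<Rightarrow> real \<Rightarrow> real \<Rightarrow> complex^3" where
  "Y0 A B k a1 a2 z0 x t = yvec A B k a1 a2 x t z0 (lambda0 A B k z0)"

definition Y1 ::
  "real \<Rightarrow> real \<Rightarrow> real \<Rightarrow> real \<Rightarrow> real \<Rightarrow> real \<Rightarrow> real \<Rightarrow> real \<Rightarrow> complex^3" where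
  "Y1 A B k a1 a2 z0 x t =
     vector_derivative (\<lambda>z. yvec A B k a1 a2 x t z (lambda0 A B k z0)) (at z0)"

definition Ys ::
  "real \<Rightarrow> real \<Rightarrow> real \<Rightarrow> real \<Rightarrow> real \<Rightarrow> real \<Rightarrow> real \<Rightarrow> real \<Rightarrow> complex^3" where
  "Ys A B k a1 a2 z0 x t =
     (if chi_s A B k z0 = 0
      then exp (\<i> * of_real (mu0 A B k z0 * t / 2)) *s
             vector [of_real (lambda0 A B k z0), u10 A k a1 x t, u20 B k a2 x t]
      else yvec A B k a1 a2 x t (chi_s A B k z0) (lambda0 A B k z0))"

definition yR ::
  "real \<Rightarrow> real \<Rightarrow> real \<Rightarrow> real \<Rightarrow> real \<Rightarrow> real \<Rightarrow> complex \<Rightarrow> complex \<Rightarrow> complex \<Rightarrow>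
   real \<Rightarrow> real \<Rightarrow> complex^3" where
  "yR A B k a1 a2 z0 M0 M1 cs x t =
     M0 *s Y0 A B k a1 a2 z0 x t + M1 *s Y1 A B k a1 a2 z0 x t + cs *s Ys A B k a1 a2 z0 x t"

subsection \<open>The indefinite form\<close>

definition Jmat :: "complex^3^3" where
  "Jmat = (\<chi> i j. if i = j then (if i = 1 then 1 else - 1) else 0)"

definition Jform :: "complex^3 \<Rightarrow> complex^3 \<Rightarrow> complex" where
  "Jform f g = (\<Sum>i\<in>UNIV. cnj (f $ i) * (Jmat *v g) $ i)"

subsection \<open>Facts justifying \<open>lambda0\<close> and \<open>chi_s\<close>\<close>

lemma Fpoly_Lambda:
  assumes "z \<noteq> 0" "z \<noteq> k" "z \<noteq> - k"
  shows "Fpoly A B k z mu = z * (z^2 - k^2) * (mu - Lambda A B k z)"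
proof -
  have "z + k \<noteq> 0" "z - k \<noteq> 0" using assms by auto
  then show ?thesis
    using assms(1) unfolding Fpoly_def Lambda_def
    by (simp add: divide_simps) algebra
qed

lemma Lambda_has_derivative:
  assumes "z \<noteq> 0" "z \<noteq> k" "z \<noteq> - k"
  shows "(Lambda A B k has_real_derivative
            (A * (h1 k z)^2 + B * (h2 k z)^2 - Lambda A B k z) / z) (at z)"
proof -
  have nz: "z + k \<noteq> 0" "z - k \<noteq> 0" "k + z \<noteq> 0" "k - z \<noteq> 0" using assms by auto
  have h2: "h2 k z ^ 2 = k^2 / (z - k)^2"
    unfolding h2_def by (simp add: power_divide power2_commute)
  have h1: "h1 k z ^ 2 = k^2 / (z + k)^2"
    unfolding h1_def by (simp add: power_divide add.commute)
  have dA: "((\<lambda>z. A / (z + k)) has_real_derivative - (A / (z + k)^2)) (at z)"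
    using nz by (auto intro!: derivative_eq_intros simp: power2_eq_square)
  have dB: "((\<lambda>z. B / (z - k)) has_real_derivative - (B / (z - k)^2)) (at z)"
    using nz by (auto intro!: derivative_eq_intros simp: power2_eq_square)
  have dG: "((\<lambda>z. 2 - k^2 * (A / (z + k) + B / (z - k))) has_real_derivative
               k^2 * (A / (z + k)^2 + B / (z - k)^2)) (at z)"
    using DERIV_diff[OF DERIV_const[of 2] DERIV_cmult[OF DERIV_add[OF dA dB], of "k^2"]]
    by (simp add: algebra_simps)
  have dI: "((\<lambda>z. 1 / z) has_real_derivative - (1 / z^2)) (at z)"
    using assms(1) by (auto intro!: derivative_eq_intros simp: power2_eq_square)
  have alg: "- (1 / z^2) * G + k^2 * (P + Q) * (1 / z) = (k^2 * P + k^2 * Q - 1 / z * G) / z"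
    for G P Q :: real
    using assms(1) by (simp add: field_simps power2_eq_square)
  have AB: "A * (h1 k z)^2 = k^2 * (A / (z + k)^2)" "B * (h2 k z)^2 = k^2 * (B / (z - k)^2)"
    unfolding h1 h2 by simp_all
  show ?thesis
    using DERIV_mult[OF dI dG] unfolding Lambda_def[abs_def] AB alg .
qed

lemma mu0_eq:
  assumes "z0 \<noteq> 0" "z0 \<noteq> k" "z0 \<noteq> - k" and "deriv (Lambda A B k) z0 = 0"
  shows "mu0 A B k z0 = A * (h1 k z0)^2 + B * (h2 k z0)^2"
  using DERIV_imp_deriv[OF Lambda_has_derivative[OF assms(1-3), of A B]] assms
  unfolding mu0_def by simp

lemma mu0_pos:
  assumes "A > 0" "B > 0" "k \<noteq> 0" "z0 \<noteq> 0" "z0 \<noteq> k" "z0 \<noteq> - k"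
    and "deriv (Lambda A B k) z0 = 0"
  shows "mu0 A B k z0 > 0"
proof -
  have "h1 k z0 \<noteq> 0" unfolding h1_def using assms by auto
  then show ?thesis
    unfolding mu0_eq[OF assms(4-7)] using assms by (simp add: add_pos_nonneg)
qed

lemma Fpoly_factor:
  assumes "A > 0" "B > 0" "k \<noteq> 0" "z0 \<noteq> 0" "z0 \<noteq> k" "z0 \<noteq> - k"
    and "deriv (Lambda A B k) z0 = 0"
  shows "Fpoly A B k z (mu0 A B k z0)
           = mu0 A B k z0 * (z - z0)^2 * (z - chi_s A B k z0)"
proof -
  define m where "m = mu0 A B k z0"
  have m: "m > 0" using mu0_pos[OF assms] by (simp add: m_def)
  have s: "m * chi_s A B k z0 = 2 - 2 * m * z0"
    using m unfolding chi_s_def m_def[symmetric] by (simp add: field_simps)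
  have nz: "z0 + k \<noteq> 0" "k + z0 \<noteq> 0" "k - z0 \<noteq> 0" using assms by auto
  have F0: "Fpoly A B k z0 m = 0"
    using Fpoly_Lambda[OF assms(4-6)] by (simp add: m_def mu0_def)
  define p where "p = 1 / (z0 + k)"
  define q where "q = 1 / (z0 - k)"
  have p: "p * (z0 + k) = 1" and q: "q * (z0 - k) = 1"
    using nz by (auto simp: p_def q_def)
  have m1: "z0 * m = 2 - k^2 * (A * p + B * q)"
    using assms(4) by (simp add: m_def mu0_def Lambda_def p_def q_def)
  have "h2 k z0 ^ 2 = k^2 * q^2" "h1 k z0 ^ 2 = k^2 * p^2"
    unfolding h1_def h2_def p_def q_def
    by (simp_all add: power_divide power2_commute add.commute)
  then have m2: "m = A * (k^2 * p^2) + B * (k^2 * q^2)"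
    using mu0_eq[OF assms(4-7)] by (simp add: m_def)
  have F1: "3 * m * z0^2 - 4 * z0 + k^2 * ((A + B) - m) = 0"
    using p q m1 m2 by algebra
  have "m * (z - z0)^2 * (z - chi_s A B k z0)
          = m * (z - z0)^2 * z - (z - z0)^2 * (2 - 2 * m * z0)"
    using s by algebra
  also have "\<dots> = Fpoly A B k z m"
    using F0 F1 unfolding Fpoly_def by algebra
  finally show ?thesis by (simp add: m_def)
qed

lemma chi_s_neq:
  assumes "A > 0" "B > 0" "k \<noteq> 0" "z0 \<noteq> 0" "z0 \<noteq> k" "z0 \<noteq> - k"
    and "deriv (Lambda A B k) z0 = 0" and "deriv (deriv (Lambda A B k)) z0 \<noteq> 0"
  shows "chi_s A B k z0 \<noteq> z0" and "chi_s A B k z0 \<noteq> k" and "chi_s A B k z0 \<noteq> - k"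
proof -
  define m where "m = mu0 A B k z0"
  note fac = Fpoly_factor[OF assms(1-7), folded m_def]
  have nz: "z0 + k \<noteq> 0" "z0 - k \<noteq> 0" "k + z0 \<noteq> 0" "k - z0 \<noteq> 0" using assms by auto
  have Fk: "Fpoly A B k k m = 2 * B * k^3" "Fpoly A B k (- k) m = - 2 * A * k^3"
    unfolding Fpoly_def by algebra+
  show "chi_s A B k z0 \<noteq> k" "chi_s A B k z0 \<noteq> - k"
    using fac[of k] fac[of "- k"] Fk assms(1-3) by auto
  show "chi_s A B k z0 \<noteq> z0"
  proof
    assume eq: "chi_s A B k z0 = z0"
    have m: "m > 0" using mu0_pos[OF assms(1-7)] by (simp add: m_def)
    then have tr: "3 * m * z0 = 2"
      using eq unfolding chi_s_def m_def[symmetric] by (simp add: field_simps)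
    define p where "p = 1 / (z0 + k)"
    define q where "q = 1 / (z0 - k)"
    have p: "p * (z0 + k) = 1" and q: "q * (z0 - k) = 1"
      using nz by (auto simp: p_def q_def)
    have m1: "z0 * m = 2 - k^2 * (A * p + B * q)"
      using assms(4) by (simp add: m_def mu0_def Lambda_def p_def q_def)
    have "h2 k z0 ^ 2 = k^2 * q^2" "h1 k z0 ^ 2 = k^2 * p^2"
      unfolding h1_def h2_def p_def q_def
      by (simp_all add: power_divide power2_commute add.commute)
    then have m2: "m = A * (k^2 * p^2) + B * (k^2 * q^2)"
      using mu0_eq[OF assms(4-7)] by (simp add: m_def)
    have "(z0 - k) * (z0 + k) * k^2 * (A * p^3 + B * q^3) = 0"
      using p q m1 m2 tr by algebra
    then have cub: "A * p^3 + B * q^3 = 0" using nz assms(3) by simp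
    define g where "g z = (A * (h1 k z)^2 + B * (h2 k z)^2 - Lambda A B k z) / z" for z
    have ev: "eventually (\<lambda>z. deriv (Lambda A B k) z = g z) (nhds z0)"
    proof -
      have "open (- {0, k, - k})" by (intro open_Compl finite_imp_closed) auto
      then have "eventually (\<lambda>z. z \<in> - {0, k, - k}) (nhds z0)"
        using assms by (intro eventually_nhds_in_open) auto
      then show ?thesis
        by eventually_elim (auto simp: g_def intro!: DERIV_imp_deriv Lambda_has_derivative)
    qed
    have d1: "(h1 k has_real_derivative - k / (k + z0)^2) (at z0)"
      unfolding h1_def[abs_def] using nz
      by (auto intro!: derivative_eq_intros simp: power2_eq_square)
    have d2: "(h2 k has_real_derivative k / (k - z0)^2) (at z0)"
      unfolding h2_def[abs_def] using nz
      by (auto intro!: derivative_eq_intros simp: power2_eq_square)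
    have g0: "A * (h1 k z0)^2 + B * (h2 k z0)^2 - Lambda A B k z0 = 0"
      using mu0_eq[OF assms(4-7)] by (simp add: mu0_def)
    have dL: "(Lambda A B k has_real_derivative 0) (at z0)"
      using Lambda_has_derivative[OF assms(4-6), of A B] g0 by simp
    have "(g has_real_derivative
            (A * (2 * h1 k z0 * (- k / (k + z0)^2)) + B * (2 * h2 k z0 * (k / (k - z0)^2))) / z0)
          (at z0)"
      unfolding g_def[abs_def]
      using g0 assms(4)
      by (auto intro!: derivative_eq_intros d1 d2 dL simp: ac_simps)
    moreover have "h1 k z0 = k * p" "h2 k z0 = - k * q" "- k / (k + z0)^2 = - (k * p^2)"
        "k / (k - z0)^2 = k * q^2"
      using nz unfolding h1_def h2_def p_def q_def
      by (auto simp: power_divide power2_commute add.commute divide_simps) algebra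
    then have "A * (2 * h1 k z0 * (- k / (k + z0)^2)) + B * (2 * h2 k z0 * (k / (k - z0)^2))
        = - 2 * k^2 * (A * p^3 + B * q^3)"
      by algebra
    ultimately have "(g has_real_derivative 0) (at z0)" using cub by simp
    then have "deriv g z0 = 0" by (rule DERIV_imp_deriv)
    moreover have "deriv (deriv (Lambda A B k)) z0 = deriv g z0"
      using ev by (rule deriv_cong_ev) simp
    ultimately show False using assms(8) by simp
  qed
qed

end

theory Submission
  imports Defs
begin

text \<open>
  For two roots \<open>\<chi>, \<eta>\<close> of the spectral cubic one has
  \<open>(\<chi> - \<eta>) (\<mu>\<^sub>0 - A h\<^sub>1(\<chi>) h\<^sub>1(\<eta>) - B h\<^sub>2(\<chi>) h\<^sub>2(\<eta>)) = 0\<close>, so the eigenvectors at distinct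
  roots are \<open>J\<close>-orthogonal; at the double root \<open>z0\<close> the eigenvector \<open>Y0\<close> is \<open>J\<close>-null, and
  differentiating the relation in \<open>\<chi>\<close> makes \<open>Y1\<close> orthogonal to \<open>Ys\<close> as well. The Gram matrix of
  \<open>Y0, Y1, Ys\<close> therefore has only the entries \<open>aJ, bJ, ds\<close>. Since \<open>J\<close> has signature \<open>(1,2)\<close> and
  \<open>Ys\<close> is orthogonal to the null vector \<open>Y0\<close> without being parallel to it, \<open>ds < 0\<close> (a
  Cauchy--Schwarz argument). The null condition for \<open>M0 = 1\<close> is then a circle in the
  \<open>M1\<close>-plane, which is nonempty exactly when its squared radius is nonnegative.
\<close>

subsection \<open>The indefinite form\<close>

lemma Jform_components:
  "Jform f g = cnj (f $ 1) * g $ 1 - cnj (f $ 2) * g $ 2 - cnj (f $ 3) * g $ 3"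
  unfolding Jform_def Jmat_def matrix_vector_mult_def by (simp add: sum_3)

lemma Jform_add_left: "Jform (f + g) h = Jform f h + Jform g h"
  by (simp add: Jform_components algebra_simps)

lemma Jform_add_right: "Jform f (g + h) = Jform f g + Jform f h"
  by (simp add: Jform_components algebra_simps)

lemma Jform_mult_left: "Jform (c *s f) g = cnj c * Jform f g"
  by (simp add: Jform_components algebra_simps)

lemma Jform_mult_right: "Jform f (c *s g) = c * Jform f g"
  by (simp add: Jform_components algebra_simps)

lemma Jform_commute: "Jform g f = cnj (Jform f g)"
  by (simp add: Jform_components algebra_simps)

text \<open>The only surviving off-diagonal entry is real, so the two mixed terms of
  \<open>f\<close> and \<open>g\<close> are complex conjugates and add up to twice a real part. The
  null vector \<open>f\<close> contributes no term in \<open>cmod a\<close>.\<close>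

lemma Jform_combination:
  fixes f g h :: "complex^3"
  assumes "Jform f f = 0" "Jform f g = of_real \<alpha>" "Jform g g = of_real \<beta>"
    and "Jform f h = 0" "Jform g h = 0" "Jform h h = of_real \<delta>"
  defines "v a b c \<equiv> a *s f + b *s g + c *s h"
  shows "Jform (v a b c) (v a b c)
           = of_real (\<beta> * (cmod b)^2 + 2 * \<alpha> * Re (cnj a * b) + \<delta> * (cmod c)^2)"
proof -
  have "Jform g f = of_real \<alpha>" "Jform h f = 0" "Jform h g = 0"
    using Jform_commute[of g f] Jform_commute[of h f] Jform_commute[of h g] assms by simp_all
  then have "Jform (v a b c) (v a b c)
      = of_real \<alpha> * (cnj a * b + cnj (cnj a * b)) + of_real \<beta> * (cnj b * b)
        + of_real \<delta> * (cnj c * c)"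
    using assms by (simp add: v_def Jform_add_left Jform_add_right Jform_mult_left
        Jform_mult_right algebra_simps)
  also have "\<dots> = of_real (\<beta> * (cmod b)^2 + 2 * \<alpha> * Re (cnj a * b) + \<delta> * (cmod c)^2)"
    by (simp only: complex_add_cnj mult.commute[of "cnj b" b] mult.commute[of "cnj c" c]
        complex_norm_square[symmetric]) (simp add: algebra_simps)
  finally show ?thesis .
qed

text \<open>\<open>Y0\<close>, \<open>Y1\<close> and \<open>Ys\<close> all have this shape. The
  plane waves \<open>u\<close>, \<open>v\<close> enter the form only through their squared moduli,
  and a shared unimodular factor \<open>e\<close> cancels; this removes most of the dependence on
  \<open>x\<close> and \<open>t\<close>.\<close>

lemma Jform_common_phases:
  assumes "(cmod u)^2 = A" "(cmod v)^2 = B"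
  shows "Jform (vector [a * e, u * b * e, v * c * e])
               (vector [a' * e', u * b' * e', v * c' * e'])
         = cnj e * e' * (cnj a * a' - of_real A * cnj b * b' - of_real B * cnj c * c')"
proof -
  have "cnj u * u = of_real A" "cnj v * v = of_real B"
    using assms by (metis complex_norm_square mult.commute)+
  then have "cnj e * e' * (cnj a * a' - of_real A * cnj b * b' - of_real B * cnj c * c')
      = cnj e * e' * (cnj a * a' - (cnj u * u) * cnj b * b' - (cnj v * v) * cnj c * c')"
    by simp
  then show ?thesis
    by (simp add: Jform_components algebra_simps)
qed

subsection \<open>The generalized eigenvector\<close>

lemma has_vector_derivative_vec:
  fixes f :: "real \<Rightarrow> 'a::real_normed_vector ^ 'n"
  assumes "\<And>i. ((\<lambda>z. f z $ i) has_vector_derivative f' $ i) (at z)"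
  shows "(f has_vector_derivative f') (at z)"
  using assms unfolding has_vector_derivative_def has_derivative_def
  by (auto intro!: vec_tendstoI bounded_linear_scaleR_left)

lemma h_has_real_derivative:
  assumes "k + z \<noteq> 0" "k - z \<noteq> 0"
  shows "(h1 k has_real_derivative - k / (k + z)^2) (at z)"
    and "(h2 k has_real_derivative k / (k - z)^2) (at z)"
  unfolding h1_def[abs_def] h2_def[abs_def] using assms
  by (auto intro!: derivative_eq_intros simp: power2_eq_square)

text \<open>\<open>\<theta>\<close> is the derivative of the real phase in \<open>z\<close>. By the
  product rule each component yields its amplitude derivative plus \<open>\<i> * \<theta>\<close>
  times itself, so apart from the plane waves and the common phase, \<open>x\<close> and
  \<open>t\<close> occur only in \<open>\<theta>\<close>.\<close>

lemma yvec_has_vector_derivative: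
  fixes A B k x t z :: real
  assumes "z \<noteq> 0" "k + z \<noteq> 0" "k - z \<noteq> 0"
  defines "\<theta> \<equiv> x - (2 - k * (A - B)) / (2 * z^2) * t"
  shows "((\<lambda>z. yvec A B k a1 a2 x t z lam) has_vector_derivative
     vector [\<i> * of_real \<theta> * of_real lam * Ephase A B k x t z,
       u10 A k a1 x t * (of_real (- k / (k + z)^2) + \<i> * of_real \<theta> * of_real (h1 k z))
         * Ephase A B k x t z,
       u20 B k a2 x t * (of_real (k / (k - z)^2) + \<i> * of_real \<theta> * of_real (h2 k z))
         * Ephase A B k x t z]) (at z)"
proof (rule has_vector_derivative_vec)
  note h = h_has_real_derivative[OF assms(2,3)]
  have ph: "((\<lambda>z. z * x + nu A B k z * t) has_real_derivative \<theta>) (at z)"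
  proof -
    have "((\<lambda>z. c / (2 * z)) has_real_derivative - (c / (2 * z^2))) (at z)" for c
      using assms(1) by (auto intro!: derivative_eq_intros simp: power2_eq_square)
    from DERIV_add[OF DERIV_const[of "(A + B) / 2"] this[of "2 - k * (A - B)"]]
    have "(nu A B k has_real_derivative - ((2 - k * (A - B)) / (2 * z^2))) (at z)"
      unfolding nu_def[abs_def] by simp
    from DERIV_add[OF DERIV_cmult_right[OF DERIV_ident, of x] DERIV_cmult_right[OF this, of t]]
    show ?thesis by (rule DERIV_cong) (simp add: \<theta>_def)
  qed
  have E: "(Ephase A B k x t has_vector_derivative \<i> * of_real \<theta> * Ephase A B k x t z) (at z)"
  proof -
    have "((\<lambda>z. \<i> * of_real (z * x + nu A B k z * t)) has_vector_derivative \<i> * of_real \<theta>) (at z)"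
      by (intro has_vector_derivative_mult_right has_vector_derivative_of_real ph)
    from field_vector_diff_chain_at[OF this DERIV_exp] show ?thesis
      unfolding Ephase_def[abs_def] by (simp add: o_def)
  qed
  have P: "((\<lambda>z. c * of_real (h z) * Ephase A B k x t z) has_vector_derivative
       c * (of_real h' + \<i> * of_real \<theta> * of_real (h z)) * Ephase A B k x t z) (at z)"
    if "(h has_real_derivative h') (at z)" for c h h'
    by (rule has_vector_derivative_eq_rhs,
        rule has_vector_derivative_mult[OF has_vector_derivative_mult_right
          [OF has_vector_derivative_of_real[OF that]] E])
      (simp add: algebra_simps)
  have C: "((\<lambda>z. of_real lam * Ephase A B k x t z) has_vector_derivative
       \<i> * of_real \<theta> * of_real lam * Ephase A B k x t z) (at z)"
    using has_vector_derivative_mult_right[OF E, of "of_real lam"] by (simp add: algebra_simps)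
  fix i :: 3
  show "((\<lambda>z. yvec A B k a1 a2 x t z lam $ i) has_vector_derivative
     vector [\<i> * of_real \<theta> * of_real lam * Ephase A B k x t z,
       u10 A k a1 x t * (of_real (- k / (k + z)^2) + \<i> * of_real \<theta> * of_real (h1 k z))
         * Ephase A B k x t z,
       u20 B k a2 x t * (of_real (k / (k - z)^2) + \<i> * of_real \<theta> * of_real (h2 k z))
         * Ephase A B k x t z] $ i) (at z)"
    using exhaust_3[of i] C P[OF h(1), of "u10 A k a1 x t"] P[OF h(2), of "u20 B k a2 x t"]
    unfolding yvec_def by auto
qed

subsection \<open>Gram data at a critical point\<close>

context
  fixes A B k z0 :: real
  assumes AB: "A > 0" "B > 0" and k: "k \<noteq> 0"
    and z0: "z0 \<noteq> 0" "z0 \<noteq> k" "z0 \<noteq> - k"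
    and crit: "deriv (Lambda A B k) z0 = 0" "deriv (deriv (Lambda A B k)) z0 \<noteq> 0"
begin

section \<open>Algebraic relations between the double root and the simple root\<close>

private definition "s = chi_s A B k z0"
private definition "m = mu0 A B k z0"
text \<open>Naming the reciprocals as variables bound by the relations \<open>inverses\<close> turns
  rational identities into polynomial ones that \<open>algebra\<close> can decide.\<close>

private definition "p = 1 / (z0 + k)"
private definition "q = 1 / (z0 - k)"
private definition "p' = 1 / (s + k)"
private definition "q' = 1 / (s - k)"

private lemma s_neq: "s \<noteq> z0" "s \<noteq> k" "s \<noteq> - k"
  unfolding s_def using chi_s_neq[OF AB k z0 crit] by auto

private lemma inverses: "p * (z0 + k) = 1" "q * (z0 - k) = 1" "p' * (s + k) = 1" "q' * (s - k) = 1"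
  using z0 s_neq by (auto simp: p_def q_def p'_def q'_def)

private lemma h_eq: "h1 k z0 = k * p" "h2 k z0 = - k * q" "h1 k s = k * p'" "h2 k s = - k * q'"
  "- k / (k + z0)^2 = - k * p^2" "k / (k - z0)^2 = k * q^2"
  using minus_divide_right[of k "z0 - k"] minus_divide_right[of k "s - k"]
  by (simp_all add: h1_def h2_def p_def q_def p'_def q'_def power_divide power2_commute add.commute)

private lemma m_pos: "m > 0"
  unfolding m_def by (rule mu0_pos[OF AB k z0 crit(1)])

text \<open>This is the critical point equation for \<open>Lambda\<close>; below it makes
  \<open>Y0\<close> null.\<close>

private lemma m_double: "m = k^2 * (A * p^2 + B * q^2)"
  using mu0_eq[OF z0 crit(1)] unfolding m_def h_eq by (simp add: algebra_simps power_mult_distrib)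

text \<open>The spectral equations at \<open>z0\<close> and \<open>s\<close> are subtracted and
  divided by \<open>z0 - s\<close>, using \<open>p - p' = (s - z0) * p * p'\<close> and its analogue
  for \<open>q\<close>. The result makes \<open>Y0\<close> orthogonal to \<open>Ys\<close>.\<close>

private lemma m_simple: "m = k^2 * (A * p * p' + B * q * q')"
proof -
  have "m * z0 = 2 - k^2 * (A * p + B * q)"
    using z0 by (simp add: m_def mu0_def Lambda_def p_def q_def)
  moreover have "m * s = 2 - k^2 * (A * p' + B * q')"
  proof -
    \<comment> \<open>The cubic is used in place of \<open>Lambda\<close> because
      \<open>s = 0\<close> is allowed.\<close>
    have "m * s^3 - 2 * s^2 + k^2 * ((A + B) - m) * s + k^2 * (2 - k * (A - B)) = 0"
      using Fpoly_factor[OF AB k z0 crit(1), of s] unfolding m_def s_def Fpoly_def by simp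
    then have "(s - k) * (s + k) * (m * s - (2 - k^2 * (A * p' + B * q'))) = 0"
      using inverses by algebra
    then show ?thesis using s_neq by auto
  qed
  ultimately have "(z0 - s) * (m - k^2 * (A * p * p' + B * q * q')) = 0"
    using inverses by algebra
  then show ?thesis using s_neq by simp
qed

text \<open>Subtracting \<open>m_simple\<close> from \<open>m_double\<close> leaves a factor
  \<open>s - z0\<close>. The remaining sum is the part of the pairing of \<open>Y1\<close> with
  \<open>Ys\<close> that comes from the derivatives of \<open>h1\<close> and
  \<open>h2\<close>.\<close>

private lemma derivative_orthogonal: "A * p^2 * p' + B * q^2 * q' = 0"
proof -
  have "k^2 * (s - z0) * (A * p^2 * p' + B * q^2 * q') = 0"
    using m_double m_simple inverses by algebra
  then show ?thesis using s_neq k by simp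
qed

text \<open>Otherwise the weights \<open>A * p^3\<close>, \<open>B * q^3\<close> would annihilate
  both \<open>(1, 1)\<close> and \<open>(p', q')\<close>, forcing \<open>p' = q'\<close> and hence
  \<open>k = 0\<close>. The sum is \<open>aJ\<close> up to the factor \<open>k^2\<close>.\<close>

private lemma cubic_neq: "A * p^3 + B * q^3 \<noteq> 0"
proof
  assume c: "A * p^3 + B * q^3 = 0"
  have "(s - z0) * (A * p^3 * p' + B * q^3 * q') = 0"
    using c derivative_orthogonal inverses by algebra
  then have "A * p^3 * p' + B * q^3 * q' = 0" using s_neq by simp
  then have "A * p^3 * (p' - q') = 0" using c by algebra
  moreover have "p \<noteq> 0" using inverses by auto
  ultimately have "p' = q'" using AB by simp
  then have "s + k = s - k" by (simp add: p'_def q'_def)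
  then show False using k by simp
qed

text \<open>Lagrange's identity for \<open>(p, q)\<close> and \<open>(p', q')\<close> with weights
  \<open>A\<close>, \<open>B\<close>: the Gram determinant is positive because the vectors are not
  parallel, and by \<open>m_double\<close> and \<open>m_simple\<close> it equals
  \<open>- m * ds\<close>.\<close>

private lemma simple_negative: "m - k^2 * (A * p'^2 + B * q'^2) < 0"
proof -
  have "p * q' - q * p' \<noteq> 0"
  proof
    assume "p * q' - q * p' = 0"
    then have "k * (z0 - s) = 0" using inverses by algebra
    then show False using k s_neq by simp
  qed
  then have "k^4 * (A * B * (p * q' - q * p')^2) > 0" using AB k by simp
  also have "k^4 * (A * B * (p * q' - q * p')^2)
      = (k^2 * (A * p^2 + B * q^2)) * (k^2 * (A * p'^2 + B * q'^2))
        - (k^2 * (A * p * p' + B * q * q'))^2"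
    by algebra
  also have "\<dots> = - (m * (m - k^2 * (A * p'^2 + B * q'^2)))"
    unfolding m_double[symmetric] m_simple[symmetric] by algebra
  finally show ?thesis using m_pos by (simp add: mult_less_0_iff)
qed

private lemma lambda0_square: "lambda0 A B k z0 ^ 2 = m"
  using m_pos by (simp add: lambda0_def m_def)

text \<open>The three constants are quantified before \<open>x\<close> and \<open>t\<close>, which
  records that the Gram matrix is constant in space and time.\<close>

lemma gram:
  assumes a: "a1^2 = A" "a2^2 = B"
  shows "\<exists>aJ bJ ds. aJ \<noteq> 0 \<and> bJ < 0 \<and> ds < 0 \<and> (\<forall>x t.
    Jform (Y0 A B k a1 a2 z0 x t) (Y0 A B k a1 a2 z0 x t) = 0 \<and>
    Jform (Y0 A B k a1 a2 z0 x t) (Y1 A B k a1 a2 z0 x t) = of_real aJ \<and>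
    Jform (Y1 A B k a1 a2 z0 x t) (Y1 A B k a1 a2 z0 x t) = of_real bJ \<and>
    Jform (Y0 A B k a1 a2 z0 x t) (Ys A B k a1 a2 z0 x t) = 0 \<and>
    Jform (Y1 A B k a1 a2 z0 x t) (Ys A B k a1 a2 z0 x t) = 0 \<and>
    Jform (Ys A B k a1 a2 z0 x t) (Ys A B k a1 a2 z0 x t) = of_real ds)"
proof (intro exI conjI allI)
  \<comment> \<open>These are the expressions in \<open>h1\<close>, \<open>h2\<close> and their
    derivatives at \<open>z0\<close>, rewritten by \<open>h_eq\<close>; the signs in
    \<open>?aJ\<close> are positive because each product of \<open>h\<close> with its derivative
    contributes another minus sign or \<open>h2 k z0 = - k * q\<close> does.\<close>
  let ?aJ = "k^2 * (A * p^3 + B * q^3)"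
  let ?bJ = "- (k^2 * (A * p^4 + B * q^4))"
  let ?ds = "m - k^2 * (A * p'^2 + B * q'^2)"
  show "?aJ \<noteq> 0" using cubic_neq k by simp
  have "p \<noteq> 0" using inverses by auto
  then show "?bJ < 0" using AB k by (simp add: add_pos_nonneg)
  show "?ds < 0" by (rule simple_negative)
  fix x t
  define u where "u = u10 A k a1 x t"
  define v where "v = u20 B k a2 x t"
  define l where "l = lambda0 A B k z0"
  define E where "E = Ephase A B k x t z0"
  define Es where "Es = (if s = 0 then exp (\<i> * of_real (m * t / 2)) else Ephase A B k x t s)"
  define \<theta> where "\<theta> = x - (2 - k * (A - B)) / (2 * z0^2) * t"
  have uv: "(cmod u)^2 = A" "(cmod v)^2 = B"
    using a by (simp_all add: u_def v_def u10_def u20_def norm_mult del: of_real_add of_real_mult)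
  have "cmod E = 1" "cmod Es = 1"
    by (simp_all add: E_def Es_def Ephase_def del: of_real_add of_real_mult of_real_divide)
  then have E: "cnj E * E = 1" "cnj Es * Es = 1"
    by (metis complex_norm_square mult.commute of_real_1 power_one)+
  have Y0: "Y0 A B k a1 a2 z0 x t
      = vector [of_real l * E, u * of_real (k * p) * E, v * of_real (- k * q) * E]"
    unfolding Y0_def yvec_def u_def v_def l_def E_def h_eq ..
  have nz: "k + z0 \<noteq> 0" "k - z0 \<noteq> 0" using z0 by auto
  have Y1: "Y1 A B k a1 a2 z0 x t
      = vector [\<i> * of_real \<theta> * of_real l * E,
          u * (of_real (- k * p^2) + \<i> * of_real \<theta> * of_real (k * p)) * E,
          v * (of_real (k * q^2) + \<i> * of_real \<theta> * of_real (- k * q)) * E]"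
    unfolding Y1_def
    using vector_derivative_at[OF yvec_has_vector_derivative[OF z0(1) nz]]
    unfolding u_def v_def l_def E_def h_eq \<theta>_def by blast
  have Ys: "Ys A B k a1 a2 z0 x t
      = vector [of_real l * Es, u * of_real (k * p') * Es, v * of_real (- k * q') * Es]"
  proof (cases "s = 0")
    case True
    \<comment> \<open>At \<open>s = 0\<close> both amplitudes are 1, so the separately defined
      vector has the same shape and differs only in the unimodular factor \<open>Es\<close>.\<close>
    then have "k * p' = 1" "- k * q' = 1" using k by (simp_all add: p'_def q'_def)
    with True show ?thesis
      unfolding Ys_def
      by (simp add: Es_def u_def v_def l_def s_def m_def vec_eq_iff forall_3 mult.commute)
  next
    case False
    then show ?thesis
      unfolding Ys_def s_def[symmetric] yvec_def h_eq by (simp add: Es_def u_def v_def l_def)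
  qed
  note J = Jform_common_phases[OF uv]
  have l: "l^2 = m" unfolding l_def by (rule lambda0_square)
  have double: "l * l - A * (k * p) * (k * p) - B * (- k * q) * (- k * q) = 0"
    using l m_double by (simp add: power2_eq_square algebra_simps)
  have simple: "l * l - A * (k * p) * (k * p') - B * (- k * q) * (- k * q') = 0"
    using l m_simple by (simp add: power2_eq_square algebra_simps)
  note cx = complex_eq_iff power2_eq_square power3_eq_cube power4_eq_xxxx
  show "Jform (Y0 A B k a1 a2 z0 x t) (Y0 A B k a1 a2 z0 x t) = 0"
    unfolding Y0 J E using double by (simp add: complex_eq_iff)
  show "Jform (Y0 A B k a1 a2 z0 x t) (Y1 A B k a1 a2 z0 x t) = of_real ?aJ"
  proof -
    \<comment> \<open>The imaginary part of the pairing is \<open>\<theta>\<close> times the nullity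
      relation of \<open>Y0\<close>, so it vanishes.\<close>
    have "\<theta> * (l * l - A * (k * p) * (k * p) - B * (- k * q) * (- k * q)) = 0"
      using double by simp
    then show ?thesis unfolding Y0 Y1 J E by (simp add: cx algebra_simps)
  qed
  show "Jform (Y1 A B k a1 a2 z0 x t) (Y1 A B k a1 a2 z0 x t) = of_real ?bJ"
  proof -
    \<comment> \<open>The same relation kills the term quadratic in \<open>\<theta>\<close>, leaving
      only the amplitude derivatives.\<close>
    have "\<theta> * \<theta> * (l * l - A * (k * p) * (k * p) - B * (- k * q) * (- k * q)) = 0"
      using double by simp
    then show ?thesis unfolding Y1 J E by (simp add: cx algebra_simps)
  qed
  show "Jform (Y0 A B k a1 a2 z0 x t) (Ys A B k a1 a2 z0 x t) = 0"
    unfolding Y0 Ys J using simple by (simp add: complex_eq_iff)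
  show "Jform (Y1 A B k a1 a2 z0 x t) (Ys A B k a1 a2 z0 x t) = 0"
  proof -
    \<comment> \<open>The first relation removes the imaginary part of the pairing, the second its
      real part.\<close>
    have "\<theta> * (l * l - A * (k * p) * (k * p') - B * (- k * q) * (- k * q')) = 0"
      "k * k * (A * (p * p) * p' + B * (q * q) * q') = 0"
      using simple derivative_orthogonal by (simp_all add: power2_eq_square)
    then have "cnj (\<i> * of_real \<theta> * of_real l) * of_real l
        - of_real A * cnj (of_real (- k * p^2) + \<i> * of_real \<theta> * of_real (k * p)) * of_real (k * p')
        - of_real B * cnj (of_real (k * q^2) + \<i> * of_real \<theta> * of_real (- k * q))
          * of_real (- k * q') = 0"
      by (simp add: cx algebra_simps)
    then show ?thesis unfolding Y1 Ys J by simp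
  qed
  show "Jform (Ys A B k a1 a2 z0 x t) (Ys A B k a1 a2 z0 x t) = of_real ?ds"
    using l unfolding Ys J E by (simp add: cx algebra_simps)
qed

end

subsection \<open>The null circle\<close>

text \<open>Division by \<open>b\<close> and completion of the square in
  \<open>Re M\<close>.\<close>

lemma null_circle_iff:
  fixes a b d :: real
  assumes "b \<noteq> 0"
  shows "b * (cmod M)^2 + 2 * a * Re M + d * (cmod c)^2 = 0 \<longleftrightarrow>
         (Re M + a / b)^2 + (Im M)^2 = (a / b)^2 - (d / b) * (cmod c)^2"
proof -
  have "b * (cmod M)^2 + 2 * a * Re M + d * (cmod c)^2
      = b * ((Re M + a / b)^2 + (Im M)^2 - ((a / b)^2 - (d / b) * (cmod c)^2))"
    unfolding cmod_power2[of M] using assms by (simp add: field_simps power2_eq_square)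
  then show ?thesis using assms by simp
qed

lemma null_circle_nonempty_iff:
  fixes a b d :: real
  assumes "b < 0" "d < 0"
  shows "(\<exists>M. b * (cmod M)^2 + 2 * a * Re M + d * (cmod c)^2 = 0) \<longleftrightarrow>
         (cmod c)^2 \<le> a^2 / (b * d)"
proof -
  have "(cmod c)^2 \<le> a^2 / (b * d) \<longleftrightarrow> 0 \<le> (a / b)^2 - (d / b) * (cmod c)^2" (is "?L \<longleftrightarrow> 0 \<le> ?r")
  proof -
    \<comment> \<open>The squared radius is a positive multiple of the slack in the bound on
      \<open>cmod c\<close>.\<close>
    have "?r = (d / b) * (a^2 / (b * d) - (cmod c)^2)"
      using assms by (simp add: field_simps power2_eq_square)
    moreover have "d / b > 0" using assms by (simp add: divide_neg_neg)
    ultimately show ?thesis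
      by (metis diff_ge_0_iff_ge mult_le_cancel_left_pos mult_zero_right)
  qed
  moreover have "(\<exists>M. (Re M + a / b)^2 + (Im M)^2 = ?r) \<longleftrightarrow> 0 \<le> ?r"
  proof
    assume "0 \<le> ?r"
    \<comment> \<open>The witness is the rightmost point of the circle: centre
      \<open>- a / b\<close> plus radius.\<close>
    then have "(Re (Complex (sqrt ?r - a / b) 0) + a / b)^2 + (Im (Complex (sqrt ?r - a / b) 0))^2 = ?r"
      by simp
    then show "\<exists>M. (Re M + a / b)^2 + (Im M)^2 = ?r" by blast
  qed (metis add_nonneg_nonneg zero_le_power2)
  ultimately show ?thesis using null_circle_iff[of b] assms by simp
qed

section \<open>Null vectors in the span of \<open>Y0\<close>, \<open>Y1\<close> and
  \<open>Ys\<close>\<close>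

theorem proposition16:
  fixes A B k a1 a2 z0 :: real
  assumes "A > 0" and "B > 0" and "k \<noteq> 0"
    and "a1^2 = A" and "a2^2 = B"
    and "z0 \<notin> {0, k, - k}"
    and "deriv (Lambda A B k) z0 = 0"
    and "deriv (deriv (Lambda A B k)) z0 \<noteq> 0"
  shows "\<exists>aJ bJ ds :: real.
    (\<forall>x t. Jform (Y0 A B k a1 a2 z0 x t) (Y1 A B k a1 a2 z0 x t) = of_real aJ \<and>
           Jform (Y1 A B k a1 a2 z0 x t) (Y1 A B k a1 a2 z0 x t) = of_real bJ \<and>
           Jform (Ys A B k a1 a2 z0 x t) (Ys A B k a1 a2 z0 x t) = of_real ds) \<and>
    aJ \<noteq> 0 \<and> bJ < 0 \<and> ds < 0 \<and>
    (\<forall>x t M0 M1 cs.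
       yR A B k a1 a2 z0 M0 M1 cs x t \<noteq> 0 \<longrightarrow>
       Jform (yR A B k a1 a2 z0 M0 M1 cs x t) (yR A B k a1 a2 z0 M0 M1 cs x t) = 0 \<longrightarrow>
       M0 \<noteq> 0) \<and>
    (\<forall>x t M1 cs.
       Jform (yR A B k a1 a2 z0 1 M1 cs x t) (yR A B k a1 a2 z0 1 M1 cs x t) = 0 \<longleftrightarrow>
       bJ * (cmod M1)^2 + 2 * aJ * Re M1 + ds * (cmod cs)^2 = 0) \<and>
    (\<forall>M1 cs.
       bJ * (cmod M1)^2 + 2 * aJ * Re M1 + ds * (cmod cs)^2 = 0 \<longleftrightarrow>
       (Re M1 + aJ / bJ)^2 + (Im M1)^2 = (aJ / bJ)^2 - (ds / bJ) * (cmod cs)^2) \<and>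
    (\<forall>cs.
       (\<exists>M1. \<forall>x t.
          Jform (yR A B k a1 a2 z0 1 M1 cs x t) (yR A B k a1 a2 z0 1 M1 cs x t) = 0) \<longleftrightarrow>
       (cmod cs)^2 \<le> aJ^2 / (bJ * ds))"
proof -
  have z0: "z0 \<noteq> 0" "z0 \<noteq> k" "z0 \<noteq> - k" using assms(6) by auto
  obtain aJ bJ ds where signs: "aJ \<noteq> 0" "bJ < 0" "ds < 0" and gram:
    "\<And>x t. Jform (Y0 A B k a1 a2 z0 x t) (Y0 A B k a1 a2 z0 x t) = 0"
    "\<And>x t. Jform (Y0 A B k a1 a2 z0 x t) (Y1 A B k a1 a2 z0 x t) = of_real aJ"
    "\<And>x t. Jform (Y1 A B k a1 a2 z0 x t) (Y1 A B k a1 a2 z0 x t) = of_real bJ"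
    "\<And>x t. Jform (Y0 A B k a1 a2 z0 x t) (Ys A B k a1 a2 z0 x t) = 0"
    "\<And>x t. Jform (Y1 A B k a1 a2 z0 x t) (Ys A B k a1 a2 z0 x t) = 0"
    "\<And>x t. Jform (Ys A B k a1 a2 z0 x t) (Ys A B k a1 a2 z0 x t) = of_real ds"
    using gram[OF assms(1-3) z0 assms(7,8,4,5)] by blast
  have form: "Jform (yR A B k a1 a2 z0 M0 M1 cs x t) (yR A B k a1 a2 z0 M0 M1 cs x t)
      = of_real (bJ * (cmod M1)^2 + 2 * aJ * Re (cnj M0 * M1) + ds * (cmod cs)^2)" for M0 M1 cs x t
    unfolding yR_def by (rule Jform_combination[OF gram])
  have "M0 \<noteq> 0"
    if nz: "yR A B k a1 a2 z0 M0 M1 cs x t \<noteq> 0"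
      and null: "Jform (yR A B k a1 a2 z0 M0 M1 cs x t) (yR A B k a1 a2 z0 M0 M1 cs x t) = 0"
    for x t M0 M1 cs
  proof
    assume M0: "M0 = 0"
    \<comment> \<open>Without \<open>Y0\<close> the form is negative definite in \<open>M1\<close>
      and \<open>cs\<close>, so a null vector must be zero.\<close>
    then have "bJ * (cmod M1)^2 + ds * (cmod cs)^2 = 0"
      using null unfolding form of_real_eq_0_iff by simp
    moreover have "bJ * (cmod M1)^2 \<le> 0" "ds * (cmod cs)^2 \<le> 0"
      using signs by (simp_all add: mult_nonpos_nonneg)
    ultimately have "bJ * (cmod M1)^2 = 0" "ds * (cmod cs)^2 = 0" by linarith+
    then show False using signs nz M0 by (simp add: yR_def)
  qed
  \<comment> \<open>The right-hand side is free of \<open>x\<close> and \<open>t\<close>, so one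
    \<open>M1\<close> serves all points at once.\<close>
  moreover have null_iff:
    "Jform (yR A B k a1 a2 z0 1 M1 cs x t) (yR A B k a1 a2 z0 1 M1 cs x t) = 0 \<longleftrightarrow>
     bJ * (cmod M1)^2 + 2 * aJ * Re M1 + ds * (cmod cs)^2 = 0" for x t M1 cs
    unfolding form of_real_eq_0_iff by simp
  moreover note null_circle_iff[of bJ _ aJ ds] null_circle_nonempty_iff[OF signs(2,3), of aJ]
  ultimately show ?thesis
    using signs gram by (intro exI[of _ aJ] exI[of _ bJ] exI[of _ ds]) auto
qed

end
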